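(* Let $n\ge 1$ and let $W\colon\mathbb{R}^n\to\mathbb{R}$ be a radially symmetric function of class $C^2$, written $W(x)=w(|x|)$, such that: (i) $W(0)=0$ and there is $R>0$ such that $W(x)<0$ if $0<|x|<R$ and $W(x)\ge 0$ if $|x|\ge R$; (ii) there exist $\alpha>2$ and $C>0$ such that $w'(r)\,r^{1-\alpha}\to -C$ as $r\to 0^+$. Let $E(\mu)=\frac12\int_{\mathbb{R}^n}\int_{\mathbb{R}^n}W(x-y)\,d\mu(x)\,d\mu(y)$ be the interaction energy on the set $\mathcal{P}(\mathbb{R}^n)$ of Borel probability measures. Let $\mu\in\mathcal{P}(\mathbb{R}^n)$ be a $d_\infty$-local minimizer of $E$ with $E(\mu)<\infty$. Then every point in the support of $\mu$ is isolated (in $\operatorname{supp}\mu$). If moreover $\mu$ is a global minimizer of $E$, then $\operatorname{supp}\mu$ consists of finitely many points.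
   Context: The energy $E$ takes values in $\mathbb{R}\cup\{+\infty\}$. The $\infty$-Wasserstein distance between $\mu,\nu\in\mathcal{P}(\mathbb{R}^n)$ is $d_\infty(\mu,\nu)=\inf_{\pi\in\Pi(\mu,\nu)}\sup_{(x,y)\in\operatorname{supp}\pi}|x-y|$, where $\Pi(\mu,\nu)$ is the set of probability measures on $\mathbb{R}^n\times\mathbb{R}^n$ with first marginal $\mu$ and second marginal $\nu$. A measure $\mu\in\mathcal{P}(\mathbb{R}^n)$ is a $d_\infty$-local minimizer of $E$ if there exists $\varepsilon>0$ such that $E(\mu)\le E(\nu)$ for all $\nu\in\mathcal{P}(\mathbb{R}^n)$ with $d_\infty(\mu,\nu)<\varepsilon$. It is a global minimizer if $E(\mu)\le E(\nu)$ for all $\nu\in\mathcal{P}(\mathbb{R}^n)$. *)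

theory Defs
  imports "HOL-Probability.Probability"
begin

definition prob_measures :: "'a::euclidean_space measure set" where
  "prob_measures = {\<mu>. prob_space \<mu> \<and> sets \<mu> = sets borel}"

definition supp :: "'a::topological_space measure \<Rightarrow> 'a set" where
  "supp \<mu> = {x. \<forall>U. open U \<longrightarrow> x \<in> U \<longrightarrow> 0 < emeasure \<mu> U}"

definition couplings ::
  "'a::euclidean_space measure \<Rightarrow> 'a measure \<Rightarrow> ('a \<times> 'a) measure set" where
  "couplings \<mu> \<nu> =
     {\<pi> \<in> prob_measures. distr \<pi> borel fst = \<mu> \<and> distr \<pi> borel snd = \<nu>}"

definition d_inf :: "'a::euclidean_space measure \<Rightarrow> 'a measure \<Rightarrow> ennreal" where
  "d_inf \<mu> \<nu> = (INF \<pi>\<in>couplings \<mu> \<nu>. SUP (x, y)\<in>supp \<pi>. ennreal (norm (x - y)))"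

definition C2 :: "('a::real_normed_vector \<Rightarrow> real) \<Rightarrow> bool" where
  "C2 f \<longleftrightarrow> (\<exists>(f' :: 'a \<Rightarrow> 'a \<Rightarrow>\<^sub>L real) (f'' :: 'a \<Rightarrow> 'a \<Rightarrow>\<^sub>L 'a \<Rightarrow>\<^sub>L real).
     (\<forall>x. (f has_derivative blinfun_apply (f' x)) (at x)) \<and>
     (\<forall>x. (f' has_derivative blinfun_apply (f'' x)) (at x)) \<and>
     continuous_on UNIV f'')"

text \<open>
  The integral of an extended-real function as the integral of its positive part minus that of
  its negative part; \<^term>\<open>e2ennreal\<close> sends negative values to 0. It is meaningful when
  one of the two is finite. This is the case in the energy below for every continuous \<open>W\<close>
  that is nonnegative outside a ball, since such a \<open>W\<close> is bounded below and the
  measures are finite.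
\<close>

definition ext_integral :: "'a measure \<Rightarrow> ('a \<Rightarrow> ereal) \<Rightarrow> ereal" where
  "ext_integral M f =
     enn2ereal (\<integral>\<^sup>+ x. e2ennreal (f x) \<partial>M) - enn2ereal (\<integral>\<^sup>+ x. e2ennreal (- f x) \<partial>M)"

definition energy :: "('a::euclidean_space \<Rightarrow> real) \<Rightarrow> 'a measure \<Rightarrow> ereal" where
  "energy W \<mu> =
     ereal (1/2) * ext_integral \<mu> (\<lambda>y. ext_integral \<mu> (\<lambda>x. ereal (W (x - y))))"

definition d_inf_local_minimizer ::
  "('a::euclidean_space measure \<Rightarrow> ereal) \<Rightarrow> 'a measure \<Rightarrow> bool" where
  "d_inf_local_minimizer E \<mu> \<longleftrightarrow> \<mu> \<in> prob_measures \<and>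
     (\<exists>\<epsilon>>0. \<forall>\<nu>\<in>prob_measures. d_inf \<mu> \<nu> < ennreal \<epsilon> \<longrightarrow> E \<mu> \<le> E \<nu>)"

definition global_minimizer ::
  "('a::euclidean_space measure \<Rightarrow> ereal) \<Rightarrow> 'a measure \<Rightarrow> bool" where
  "global_minimizer E \<mu> \<longleftrightarrow> \<mu> \<in> prob_measures \<and> (\<forall>\<nu>\<in>prob_measures. E \<mu> \<le> E \<nu>)"

end

theory Submission
  imports Defs
begin

text \<open>
  \<^bold>\<open>Isolated points.\<close> If \<open>h\<close> is bounded, supported in a small ball and of
  \<open>\<mu>\<close>-mean zero, then \<open>(1 + t h) \<mu>\<close> and \<open>(1 - t h) \<mu>\<close> are both probability measures
  close to \<open>\<mu>\<close> in \<open>d\<^sub>\<infinity>\<close>, so the first variation cancels and the quadratic form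
  \<open>\<integral>\<integral> W(x - y) h(x) h(y) d\<mu> d\<mu>\<close> is nonnegative (\<open>second_variation_nonneg\<close>). Concentrating
  \<open>h\<close> near finitely many points of the support shows that \<open>W(p - q)\<close> is conditionally
  positive semidefinite on the support, locally (\<open>kernel_conditionally_nonneg_on_supp\<close>).
  For three points \<open>x, y, z\<close> this is a discriminant inequality
  (\<open>three_point_inequality\<close>), equivalent to the triangle inequalities for
  \<open>sqrt (- W)\<close>.

  Suppose support points \<open>X\<^sub>k\<close> tend to a support point \<open>x\<close>, with directions
  \<open>(X\<^sub>k - x) / |X\<^sub>k - x|\<close> tending to \<open>e\<close>. Take \<open>y = X\<^sub>k\<close>, keep a support point
  \<open>z \<noteq> x\<close> fixed, and divide the three point inequality by \<open>|X\<^sub>k - x|\<^sup>2\<close>. The left side tends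
  to the square of the derivative of \<open>W\<close> at \<open>z - x\<close> in the direction \<open>e\<close>. The right
  side tends to 0, because \<open>\<alpha> > 2\<close> makes \<open>W\<close> subquadratic at the origin. Close to \<open>x\<close> the
  radial derivative of \<open>W\<close> does not vanish, so \<open>z - x\<close> is orthogonal to \<open>e\<close>. This
  applies to \<open>z = X\<^sub>j\<close> for every \<open>j\<close>, and in the limit \<open>j \<rightarrow> \<infinity>\<close> it makes \<open>e\<close> orthogonal to
  itself, which is absurd for a unit vector.

  \<^bold>\<open>Finiteness.\<close> A global minimizer has negative energy, since two nearby equal point
  masses do. Only pairs of points at distance less than \<open>R\<close> contribute negatively. If there
  were little mass near a support point \<open>x\<close>, it would be better to delete the mass at \<open>x\<close> and
  renormalise; so the mass of \<open>ball x (2 * R)\<close> is bounded below by a constant that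
  does not depend on \<open>x\<close> (\<open>mass_near_supp_ge\<close>). As the total mass is 1, the support is bounded.
  It is also closed, hence compact, and a compact set of isolated points is finite.

  All competitors other than the two point masses are densities \<open>g \<mu>\<close> with bounded
  \<open>g\<close>. The kernel \<open>W(x - y)\<close> is integrable with respect to \<open>\<mu> \<otimes> \<mu>\<close>
  (\<open>finite_energy_imp_integrable\<close>), so the energies of these competitors are finite
  and quadratic in \<open>g\<close>.
\<close>

section \<open>The energy as a real double integral\<close>

lemma ext_integral_ereal:
  fixes f :: "'a \<Rightarrow> real"
  assumes "integrable M f"
  shows "ext_integral M (\<lambda>x. ereal (f x)) = ereal (\<integral>x. f x \<partial>M)"
proof -
  let ?P = "\<integral>\<^sup>+ x. ennreal (f x) \<partial>M" and ?N = "\<integral>\<^sup>+ x. ennreal (- f x) \<partial>M"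
  have "?P \<noteq> \<infinity>" "?N \<noteq> \<infinity>"
    using assms by (auto simp: real_integrable_def)
  then obtain p n where "?P = ennreal p" "?N = ennreal n" "0 \<le> p" "0 \<le> n"
    by (metis ennreal_cases infinity_ennreal_def)
  then show ?thesis
    unfolding ext_integral_def using assms
    by (simp add: real_lebesgue_integral_def enn2ereal_ennreal)
qed

lemma ext_integral_cong_AE:
  assumes "AE x in M. f x = g x"
  shows "ext_integral M f = ext_integral M g"
proof -
  have "(\<integral>\<^sup>+ x. e2ennreal (f x) \<partial>M) = (\<integral>\<^sup>+ x. e2ennreal (g x) \<partial>M)"
    by (rule nn_integral_cong_AE, rule AE_mp[OF assms]) simp
  moreover have "(\<integral>\<^sup>+ x. e2ennreal (- f x) \<partial>M) = (\<integral>\<^sup>+ x. e2ennreal (- g x) \<partial>M)"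
    by (rule nn_integral_cong_AE, rule AE_mp[OF assms]) simp
  ultimately show ?thesis
    by (simp add: ext_integral_def)
qed

lemma energy_eq_iterated_integral:
  assumes "AE y in M. integrable M (\<lambda>x. W (x - y))"
    and "integrable M (\<lambda>y. \<integral>x. W (x - y) \<partial>M)"
  shows "energy W M = ereal (1/2 * (\<integral>y. \<integral>x. W (x - y) \<partial>M \<partial>M))"
proof -
  have "ext_integral M (\<lambda>y. ext_integral M (\<lambda>x. ereal (W (x - y))))
      = ext_integral M (\<lambda>y. ereal (\<integral>x. W (x - y) \<partial>M))"
    by (rule ext_integral_cong_AE) (use assms(1) in eventually_elim, rule ext_integral_ereal)
  also have "\<dots> = ereal (\<integral>y. \<integral>x. W (x - y) \<partial>M \<partial>M)"
    by (rule ext_integral_ereal) fact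
  finally show ?thesis
    by (simp add: energy_def)
qed

text \<open>
  With \<open>p\<close> and \<open>n\<close> the integrals of the positive and negative part of
  \<open>x \<mapsto> W (x - y)\<close>, these bounds control the outer integrand of the energy: as \<open>n\<close> is
  bounded uniformly in \<open>y\<close>, no cancellation can hide an infinite \<open>p\<close>.
\<close>

lemma e2ennreal_le_diff_plus:
  fixes p n K :: ennreal
  assumes "n \<le> K" "K < \<infinity>"
  shows "p \<le> e2ennreal (enn2ereal p - enn2ereal n) + K"
    and "e2ennreal (enn2ereal n - enn2ereal p) \<le> K"
proof -
  have d: "e2ennreal (enn2ereal p - enn2ereal n) = p - n"
    by (cases p; cases n) (use assms in \<open>auto simp: ennreal_minus e2ennreal_neg enn2ereal_ennreal top_unique\<close>)
  show "p \<le> e2ennreal (enn2ereal p - enn2ereal n) + K"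
    unfolding d using assms
    by (metis add_left_mono diff_add_self_ennreal le_cases add_increasing order_trans zero_le)
  have "e2ennreal (enn2ereal n - enn2ereal p) = n - p"
    by (cases p; cases n) (use assms in \<open>auto simp: ennreal_minus e2ennreal_neg enn2ereal_ennreal top_unique\<close>)
  then show "e2ennreal (enn2ereal n - enn2ereal p) \<le> K"
    using assms by (metis diff_le_self_ennreal order_trans)
qed

text \<open>
  The negative part of the kernel is bounded. Finite energy therefore makes the integral of the
  positive part finite, which turns the iterated extended integral into an honest integral over
  the product space and gives access to Fubini.
\<close>

lemma finite_energy_imp_integrable:
  fixes W :: "'a::euclidean_space \<Rightarrow> real"
  assumes M: "M \<in> prob_measures" and W: "W \<in> borel_measurable borel"
    and bound: "\<And>x. - K \<le> W x" and fin: "energy W M < \<infinity>"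
  shows "integrable (M \<Otimes>\<^sub>M M) (\<lambda>z. W (snd z - fst z))"
proof -
  interpret prob_space M
    using M by (simp add: prob_measures_def)
  have one: "emeasure M (space M) = 1"
    by (rule emeasure_space_1)
  note fubini = nn_integral_fst
  interpret pair_prob_space M M ..
  have sM [measurable_cong]: "sets M = sets borel"
    using M by (simp add: prob_measures_def)
  note [measurable] = W
  let ?p = "\<lambda>y. \<integral>\<^sup>+x. ennreal (W (x - y)) \<partial>M" and ?n = "\<lambda>y. \<integral>\<^sup>+x. ennreal (- W (x - y)) \<partial>M"
  have n_le: "?n y \<le> ennreal K" for y
  proof -
    have "?n y \<le> (\<integral>\<^sup>+x. ennreal K \<partial>M)"
      by (intro nn_integral_mono ennreal_leI) (use bound minus_le_iff in blast)
    then show ?thesis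
      by (simp add: one)
  qed
  let ?P = "\<integral>\<^sup>+y. e2ennreal (enn2ereal (?p y) - enn2ereal (?n y)) \<partial>M"
  let ?N = "\<integral>\<^sup>+y. e2ennreal (enn2ereal (?n y) - enn2ereal (?p y)) \<partial>M"
  have "?N \<le> (\<integral>\<^sup>+y. ennreal K \<partial>M)"
    by (intro nn_integral_mono e2ennreal_le_diff_plus n_le) simp
  then have N: "?N < \<infinity>"
    by (simp add: one order_le_less_trans)
  have neg: "- (enn2ereal a - enn2ereal b) = enn2ereal b - enn2ereal a"
    if "b \<le> ennreal K" for a b
    using that by (cases a; cases b) (auto simp: enn2ereal_ennreal top_unique)
  have "energy W M = ereal (1/2) * (enn2ereal ?P - enn2ereal ?N)"
    by (simp add: energy_def ext_integral_def neg n_le)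
  then have P: "?P < \<infinity>"
    using fin N by (cases ?P; cases ?N) (auto simp: enn2ereal_ennreal)
  have "(\<integral>\<^sup>+y. ?p y \<partial>M) \<le> (\<integral>\<^sup>+y. e2ennreal (enn2ereal (?p y) - enn2ereal (?n y)) + ennreal K \<partial>M)"
    by (intro nn_integral_mono e2ennreal_le_diff_plus n_le) simp
  also have "\<dots> = ?P + ennreal K"
    by (subst nn_integral_add) (auto simp: one)
  also have "\<dots> < \<infinity>"
    using P by simp
  finally have "(\<integral>\<^sup>+z. ennreal (W (snd z - fst z)) \<partial>(M \<Otimes>\<^sub>M M)) < \<infinity>"
    by (subst fubini[of "\<lambda>z. ennreal (W (snd z - fst z))" M, symmetric]) auto
  moreover have "(\<integral>\<^sup>+z. ennreal (- W (snd z - fst z)) \<partial>(M \<Otimes>\<^sub>M M)) \<le> (\<integral>\<^sup>+z. ennreal K \<partial>(M \<Otimes>\<^sub>M M))"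
    by (intro nn_integral_mono ennreal_leI) (use bound minus_le_iff in blast)
  then have "(\<integral>\<^sup>+z. ennreal (- W (snd z - fst z)) \<partial>(M \<Otimes>\<^sub>M M)) < \<infinity>"
    by (simp add: P.emeasure_space_1 order_le_less_trans)
  ultimately show ?thesis
    by (auto simp: real_integrable_def less_top)
qed

text \<open>
  The bilinear form behind the energy. The first argument weights the outer variable of
  \<^const>\<open>energy\<close>, the one that is subtracted.
\<close>

definition interaction ::
  "('a::euclidean_space \<Rightarrow> real) \<Rightarrow> 'a measure \<Rightarrow> ('a \<Rightarrow> real) \<Rightarrow> ('a \<Rightarrow> real) \<Rightarrow> real" where
  "interaction W M g h = (\<integral>z. g (fst z) * h (snd z) * W (snd z - fst z) \<partial>(M \<Otimes>\<^sub>M M))"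

locale finite_energy_measure =
  fixes W :: "'a::euclidean_space \<Rightarrow> real" and M :: "'a measure"
  assumes M: "M \<in> prob_measures" and W [measurable]: "W \<in> borel_measurable borel"
    and integrable_kernel: "integrable (M \<Otimes>\<^sub>M M) (\<lambda>z. W (snd z - fst z))"
begin

sublocale M: prob_space M
  using M by (simp add: prob_measures_def)

sublocale pair_prob_space M M ..

lemma sets_M [measurable_cong]: "sets M = sets borel"
  using M by (simp add: prob_measures_def)

lemma space_M [simp]: "space M = UNIV"
  using sets_eq_imp_space_eq[OF sets_M] by simp

lemma integrable_interaction:
  assumes [measurable]: "g \<in> borel_measurable borel" "h \<in> borel_measurable borel"
    and g: "\<And>x. \<bar>g x\<bar> \<le> a" and h: "\<And>x. \<bar>h x\<bar> \<le> b"
  shows "integrable (M \<Otimes>\<^sub>M M) (\<lambda>z. g (fst z) * h (snd z) * W (snd z - fst z))"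
proof (rule Bochner_Integration.integrable_bound)
  show "integrable (M \<Otimes>\<^sub>M M) (\<lambda>z. a * b * W (snd z - fst z))"
    by (intro integrable_mult_right integrable_kernel)
  have "0 \<le> a" "0 \<le> b"
    using g[of 0] h[of 0] by linarith+
  then show "AE z in M \<Otimes>\<^sub>M M. norm (g (fst z) * h (snd z) * W (snd z - fst z))
      \<le> norm (a * b * W (snd z - fst z))"
    using g h by (auto simp: abs_mult intro!: mult_right_mono mult_mono)
qed measurable

lemma energy_density:
  assumes [measurable]: "g \<in> borel_measurable borel"
    and nn: "\<And>x. 0 \<le> g x" and g: "\<And>x. g x \<le> a"
  shows "energy W (density M g) = ereal (1/2 * interaction W M g g)"
proof -
  have int: "integrable (M \<Otimes>\<^sub>M M) (\<lambda>z. g (fst z) * g (snd z) * W (snd z - fst z))"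
    using nn g by (intro integrable_interaction[where a = a and b = a]) auto
  have int': "integrable (M \<Otimes>\<^sub>M M) (\<lambda>z. 1 * g (snd z) * W (snd z - fst z))"
    using nn g by (intro integrable_interaction[where a = 1 and b = a]) auto
  have inner: "(\<integral>x. W (x - y) \<partial>density M g) = (\<integral>x. g x * W (x - y) \<partial>M)" for y
    by (subst integral_real_density) (use nn in auto)
  have ae: "AE y in M. integrable M (\<lambda>x. g x * W (x - y))"
    using AE_integrable_fst'[OF int'] by simp
  have A: "AE y in density M g. integrable (density M g) (\<lambda>x. W (x - y))"
    using ae by (subst AE_density) (auto simp: integrable_real_density nn)
  have i2: "integrable M (\<lambda>y. g y * (\<integral>x. g x * W (x - y) \<partial>M))"
    using integrable_fst'[OF int] by (simp add: mult.assoc)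
  have B: "integrable (density M g) (\<lambda>y. \<integral>x. W (x - y) \<partial>density M g)"
    unfolding inner using i2 by (subst integrable_real_density) (use nn in auto)
  have "energy W (density M g)
      = ereal (1/2 * (\<integral>y. (\<integral>x. W (x - y) \<partial>density M g) \<partial>density M g))"
    by (rule energy_eq_iterated_integral[OF A B])
  also have "(\<integral>y. (\<integral>x. W (x - y) \<partial>density M g) \<partial>density M g)
      = (\<integral>y. g y * (\<integral>x. g x * W (x - y) \<partial>M) \<partial>M)"
    unfolding inner by (subst integral_real_density) (use nn in auto)
  also have "\<dots> = interaction W M g g"
    unfolding interaction_def using integral_fst'[OF int] by (simp add: mult.assoc)
  finally show ?thesis .
qed

lemma energy_eq_interaction: "energy W M = ereal (1/2 * interaction W M (\<lambda>_. 1) (\<lambda>_. 1))"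
  using energy_density[of "\<lambda>_. 1" 1] by (simp add: density_1)


lemma interaction_affine:
  assumes [measurable]: "h \<in> borel_measurable borel" and h: "\<And>x. \<bar>h x\<bar> \<le> b"
  shows "interaction W M (\<lambda>x. 1 + t * h x) (\<lambda>x. 1 + t * h x)
       = interaction W M (\<lambda>_. 1) (\<lambda>_. 1)
         + t * (interaction W M (\<lambda>_. 1) h + interaction W M h (\<lambda>_. 1))
         + t\<^sup>2 * interaction W M h h"
proof -
  let ?K = "\<lambda>g g' z. g (fst z) * g' (snd z) * W (snd z - fst z)"
  have int: "integrable (M \<Otimes>\<^sub>M M) (?K (\<lambda>_. 1) (\<lambda>_. 1))" "integrable (M \<Otimes>\<^sub>M M) (?K (\<lambda>_. 1) h)"
      "integrable (M \<Otimes>\<^sub>M M) (?K h (\<lambda>_. 1))" "integrable (M \<Otimes>\<^sub>M M) (?K h h)"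
    by (rule integrable_interaction[of _ _ 1 1] integrable_interaction[of _ _ 1 b]
        integrable_interaction[of _ _ b 1] integrable_interaction[of _ _ b b]; use h in simp)+
  have "?K (\<lambda>x. 1 + t * h x) (\<lambda>x. 1 + t * h x) = (\<lambda>z. ?K (\<lambda>_. 1) (\<lambda>_. 1) z
      + t * (?K (\<lambda>_. 1) h z + ?K h (\<lambda>_. 1) z) + t\<^sup>2 * ?K h h z)"
    by (simp add: fun_eq_iff algebra_simps power2_eq_square)
  then show ?thesis
    unfolding interaction_def using int by simp
qed

end

section \<open>Competitors that are close in the infinity-Wasserstein distance\<close>

lemma d_inf_le_if_coupling_concentrated:
  fixes \<mu> \<nu> :: "'a::euclidean_space measure"
  assumes "\<pi> \<in> couplings \<mu> \<nu>" and null: "emeasure \<pi> {z. r < norm (fst z - snd z)} = 0"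
  shows "d_inf \<mu> \<nu> \<le> ennreal r"
  unfolding d_inf_def
proof (rule INF_lower2[OF assms(1)], rule SUP_least)
  fix z assume "z \<in> supp \<pi>"
  moreover have "open {z :: 'a \<times> 'a. r < norm (fst z - snd z)}"
    by (intro open_Collect_less continuous_intros)
  ultimately have "\<not> r < norm (fst z - snd z)"
    using null by (force simp: supp_def)
  then show "(case z of (x, y) \<Rightarrow> ennreal (norm (x - y))) \<le> ennreal r"
    by (cases z) (auto intro!: ennreal_leI)
qed

lemma prob_measures_density:
  assumes M: "M \<in> prob_measures" and [measurable]: "g \<in> borel_measurable borel"
    and nn: "\<And>x. 0 \<le> g x" and int: "integrable M g" "(\<integral>x. g x \<partial>M) = 1"
  shows "density M g \<in> prob_measures"
proof -
  have [measurable_cong]: "sets M = sets borel"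
    using M by (simp add: prob_measures_def)
  have "(\<integral>\<^sup>+x. g x \<partial>M) = 1"
    using int nn by (subst nn_integral_eq_integral) auto
  then have "prob_space (density M g)"
    by (intro prob_spaceI) (simp add: emeasure_density cong: nn_integral_cong)
  then show ?thesis
    using M by (simp add: prob_measures_def)
qed

text \<open>
  Changing a measure inside a ball without changing the mass of the ball moves mass by at most
  the diameter of the ball. The coupling leaves a point \<open>x\<close> outside the ball where it is and
  replaces a point of the ball by an independent sample \<open>y\<close> of the normalised new measure on
  the ball; it is realised as the image of a product measure under a map \<open>T\<close>.
\<close>

lemma d_inf_density_le:
  fixes M :: "'a::euclidean_space measure"
  assumes M: "M \<in> prob_measures" and [measurable]: "g \<in> borel_measurable borel"
    and nn: "\<And>x. 0 \<le> g x" and outside: "\<And>x. x \<notin> ball a r \<Longrightarrow> g x = 1"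
    and int: "integrable M g" "(\<integral>x. g x \<partial>M) = 1"
    and pos: "0 < measure M (ball a r)"
  shows "d_inf M (density M g) \<le> ennreal (2 * r)"
proof -
  interpret prob_space M
    using M by (simp add: prob_measures_def)
  have sM [measurable_cong]: "sets M = sets borel"
    using M by (simp add: prob_measures_def)
  have spM [simp]: "space M = UNIV"
    using sets_eq_imp_space_eq[OF sM] by simp
  define A where "A = ball a r"
  define m where "m = measure M A"
  have [measurable]: "A \<in> sets borel"
    by (simp add: A_def)
  have m: "0 < m" "emeasure M A = ennreal m"
    using pos by (simp_all add: A_def m_def emeasure_eq_measure)
  define k where "k = (\<lambda>x. g x * indicator A x / m)"
  have [measurable]: "k \<in> borel_measurable borel"
    by (simp add: k_def)
  have intA: "integrable M (\<lambda>x. g x * indicator A x)"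
    using int(1) by (intro integrable_real_mult_indicator) auto
  have "(\<integral>x. g x * indicator A x \<partial>M) = (\<integral>x. g x - indicator (- A) x \<partial>M)"
    using outside by (intro Bochner_Integration.integral_cong) (auto simp: A_def indicator_def)
  also have "\<dots> = 1 - measure M (- A)"
    using int by (subst Bochner_Integration.integral_diff) (auto simp: sM emeasure_eq_measure)
  also have "\<dots> = m"
    using prob_compl[of A] by (simp add: m_def sM Compl_eq_Diff_UNIV)
  finally have k1: "(\<integral>x. k x \<partial>M) = 1"
    using m by (simp add: k_def)
  define N where "N = density M k"
  have N: "N \<in> prob_measures"
    unfolding N_def using M nn intA k1 m
    by (intro prob_measures_density) (auto simp: k_def)
  interpret N: prob_space N
    using N by (simp add: prob_measures_def)
  have sN [measurable_cong]: "sets N = sets borel"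
    using N by (simp add: prob_measures_def)
  have spN [simp]: "space N = UNIV"
    using sets_eq_imp_space_eq[OF sN] by simp
  interpret MN: pair_prob_space M N ..
  define T where "T = (\<lambda>z. (fst z, if fst z \<in> A then snd z else fst z))"
  have T [measurable]: "T \<in> (M \<Otimes>\<^sub>M N) \<rightarrow>\<^sub>M (borel :: ('a \<times> 'a) measure)"
    unfolding T_def borel_prod[symmetric] by measurable
  have borel_measurable_fst: "fst \<in> (borel :: ('a \<times> 'a) measure) \<rightarrow>\<^sub>M borel"
    and borel_measurable_snd: "snd \<in> (borel :: ('a \<times> 'a) measure) \<rightarrow>\<^sub>M borel"
    by (intro borel_measurable_continuous_onI continuous_intros)+
  define \<pi> where "\<pi> = distr (M \<Otimes>\<^sub>M N) borel T"
  have "prob_space \<pi>"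
    unfolding \<pi>_def by (rule MN.P.prob_space_distr) (rule T)
  moreover have "distr \<pi> borel fst = M"
  proof (rule measure_eqI)
    fix S assume "S \<in> sets (distr \<pi> borel fst)"
    then have [measurable]: "S \<in> sets borel"
      by simp
    have "emeasure (distr \<pi> borel fst) S = emeasure (M \<Otimes>\<^sub>M N) (S \<times> UNIV)"
      using measurable_comp[OF T borel_measurable_fst]
      by (simp add: \<pi>_def distr_distr[OF borel_measurable_fst T] emeasure_distr)
        (auto intro!: arg_cong[where f = "emeasure _"] simp: T_def space_pair_measure split: if_splits)
    also have "\<dots> = emeasure M S"
      using N.emeasure_space_1 by (subst N.emeasure_pair_measure_Times) (auto simp: sM sN)
    finally show "emeasure (distr \<pi> borel fst) S = emeasure M S" .
  qed (simp add: sM)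
  moreover have "distr \<pi> borel snd = density M g"
  proof (rule measure_eqI)
    fix S assume "S \<in> sets (distr \<pi> borel snd)"
    then have [measurable]: "S \<in> sets borel"
      by simp
    have "emeasure (distr \<pi> borel snd) S = emeasure (M \<Otimes>\<^sub>M N) (A \<times> S \<union> (S - A) \<times> UNIV)"
      using measurable_comp[OF T borel_measurable_snd]
      by (simp add: \<pi>_def distr_distr[OF borel_measurable_snd T] emeasure_distr)
        (auto intro!: arg_cong[where f = "emeasure _"] simp: T_def space_pair_measure split: if_splits)
    also have "\<dots> = emeasure (M \<Otimes>\<^sub>M N) (A \<times> S) + emeasure (M \<Otimes>\<^sub>M N) ((S - A) \<times> UNIV)"
      by (rule plus_emeasure[symmetric]) (auto intro!: pair_measureI simp: sM sN)
    also have "\<dots> = ennreal m * emeasure N S + emeasure M (S - A)"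
      using N.emeasure_space_1 m by (simp add: N.emeasure_pair_measure_Times sM sN)
    also have "ennreal m * emeasure N S = (\<integral>\<^sup>+x. ennreal m * (ennreal (k x) * indicator S x) \<partial>M)"
      by (simp add: N_def emeasure_density nn_integral_cmult sM)
    also have "emeasure M (S - A) = (\<integral>\<^sup>+x. indicator (S - A) x \<partial>M)"
      by (simp add: sM)
    also have "(\<integral>\<^sup>+x. ennreal m * (ennreal (k x) * indicator S x) \<partial>M) + (\<integral>\<^sup>+x. indicator (S - A) x \<partial>M)
        = (\<integral>\<^sup>+x. ennreal m * (ennreal (k x) * indicator S x) + indicator (S - A) x \<partial>M)"
      by (rule nn_integral_add[symmetric]) auto
    also have "\<dots> = (\<integral>\<^sup>+x. ennreal (g x) * indicator S x \<partial>M)"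
      using m nn outside
      by (intro nn_integral_cong) (auto simp: k_def A_def[symmetric] indicator_def ennreal_mult''[symmetric])
    also have "\<dots> = emeasure (density M g) S"
      by (simp add: emeasure_density sM)
    finally show "emeasure (distr \<pi> borel snd) S = emeasure (density M g) S" .
  qed (simp add: sM)
  ultimately have "\<pi> \<in> couplings M (density M g)"
    by (simp add: couplings_def prob_measures_def \<pi>_def)
  moreover have "emeasure \<pi> {z. 2 * r < norm (fst z - snd z)} = 0"
  proof -
    have "open {z :: 'a \<times> 'a. 2 * r < norm (fst z - snd z)}"
      by (intro open_Collect_less continuous_intros)
    then have [measurable]: "{z :: 'a \<times> 'a. 2 * r < norm (fst z - snd z)} \<in> sets borel"
      by simp
    have "emeasure \<pi> {z. 2 * r < norm (fst z - snd z)}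
        \<le> emeasure (M \<Otimes>\<^sub>M N) (UNIV \<times> (- A))"
      unfolding \<pi>_def
    proof (subst emeasure_distr)
      have "0 < r"
        using pos by (metis ball_empty measure_empty not_less order_less_irrefl)
      show "emeasure (M \<Otimes>\<^sub>M N) (T -` {z. 2 * r < norm (fst z - snd z)} \<inter> space (M \<Otimes>\<^sub>M N))
          \<le> emeasure (M \<Otimes>\<^sub>M N) (UNIV \<times> - A)"
      proof (rule emeasure_mono)
        show "T -` {z. 2 * r < norm (fst z - snd z)} \<inter> space (M \<Otimes>\<^sub>M N) \<subseteq> UNIV \<times> - A"
        proof clarsimp
          fix x y assume *: "2 * r < norm (fst (T (x, y)) - snd (T (x, y)))" and "y \<in> A"
          have "x \<in> A"
            using * \<open>0 < r\<close> by (auto simp: T_def split: if_splits)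
          then have "norm (x - y) < 2 * r"
            using \<open>y \<in> A\<close> dist_triangle_less_add[of x a r y r] by (simp add: A_def dist_norm norm_minus_commute)
          then show False
            using * \<open>x \<in> A\<close> by (simp add: T_def)
        qed
      qed (auto intro!: pair_measureI simp: sM sN)
    qed auto
    also have "\<dots> = emeasure N (- A)"
      using emeasure_space_1 by (subst N.emeasure_pair_measure_Times) (auto simp: sM sN)
    also have "\<dots> = (\<integral>\<^sup>+x. ennreal (k x) * indicator (- A) x \<partial>M)"
      by (simp add: N_def emeasure_density sM)
    also have "\<dots> = (\<integral>\<^sup>+x. 0 \<partial>M)"
      by (rule nn_integral_cong) (auto simp: k_def indicator_def)
    finally show ?thesis
      by simp
  qed
  ultimately show ?thesis
    by (rule d_inf_le_if_coupling_concentrated)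
qed

section \<open>The second variation\<close>

lemma measure_pos_if_supp:
  assumes M: "M \<in> prob_measures" and "x \<in> supp M" "open U" "x \<in> U"
  shows "0 < measure M U"
proof -
  interpret prob_space M
    using M by (simp add: prob_measures_def)
  show ?thesis
    using assms(2-4) by (auto simp: supp_def emeasure_eq_measure)
qed

context finite_energy_measure
begin

lemma integrable_bounded:
  fixes h :: "'a \<Rightarrow> real"
  assumes [measurable]: "h \<in> borel_measurable borel" and h: "\<And>x. \<bar>h x\<bar> \<le> b"
  shows "integrable M h"
  by (rule M.integrable_const_bound[where B = b]) (use h in auto)

lemma integral_tensor:
  fixes g h :: "'a \<Rightarrow> real"
  assumes [measurable]: "g \<in> borel_measurable borel" "h \<in> borel_measurable borel"
    and g: "\<And>x. \<bar>g x\<bar> \<le> a" and h: "\<And>x. \<bar>h x\<bar> \<le> b"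
  shows "integrable (M \<Otimes>\<^sub>M M) (\<lambda>z. g (fst z) * h (snd z))"
    and "(\<integral>z. g (fst z) * h (snd z) \<partial>(M \<Otimes>\<^sub>M M)) = (\<integral>x. g x \<partial>M) * (\<integral>x. h x \<partial>M)"
proof -
  show int: "integrable (M \<Otimes>\<^sub>M M) (\<lambda>z. g (fst z) * h (snd z))"
  proof (rule P.integrable_const_bound[where B = "a * b"])
    show "AE z in M \<Otimes>\<^sub>M M. norm (g (fst z) * h (snd z)) \<le> a * b"
      using g h abs_ge_zero[THEN order_trans, OF g] by (auto simp: abs_mult intro!: mult_mono AE_I2)
  qed measurable
  show "(\<integral>z. g (fst z) * h (snd z) \<partial>(M \<Otimes>\<^sub>M M)) = (\<integral>x. g x \<partial>M) * (\<integral>x. h x \<partial>M)"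
    using integral_fst'[OF int] by simp
qed

text \<open>
  The energies of the two densities \<open>1 + t h\<close> and \<open>1 - t h\<close> add up to twice the energy of
  the minimizer plus \<open>t\<^sup>2\<close> times the form at \<open>h\<close>, because the linear terms
  cancel. No limit \<open>t \<rightarrow> 0\<close> is taken: any \<open>t\<close> that keeps both densities nonnegative will do.
\<close>

lemma second_variation_nonneg:
  assumes [measurable]: "h \<in> borel_measurable borel" and h: "\<And>x. \<bar>h x\<bar> \<le> b"
    and outside: "\<And>x. x \<notin> ball a r \<Longrightarrow> h x = 0" and mean: "(\<integral>x. h x \<partial>M) = 0"
    and pos: "0 < measure M (ball a r)"
    and min: "\<And>\<nu>. \<nu> \<in> prob_measures \<Longrightarrow> d_inf M \<nu> \<le> ennreal (2 * r) \<Longrightarrow> energy W M \<le> energy W \<nu>"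
  shows "0 \<le> interaction W M h h"
proof -
  define t where "t = 1 / (b + 1)"
  have "0 \<le> b"
    using h[of 0] by linarith
  then have t: "0 < t" "\<bar>t * h x\<bar> \<le> 1" for x
    using h[of x] by (auto simp: t_def abs_mult field_simps)
  have intgr: "integrable M h"
    using h by (rule integrable_bounded[rotated]) simp
  have step: "interaction W M (\<lambda>_. 1) (\<lambda>_. 1) \<le> interaction W M (\<lambda>x. 1 + s * h x) (\<lambda>x. 1 + s * h x)"
    if "\<bar>s\<bar> = t" for s
  proof -
    define g where "g = (\<lambda>x. 1 + s * h x)"
    have [measurable]: "g \<in> borel_measurable borel"
      by (simp add: g_def)
    have "\<bar>s * h x\<bar> \<le> 1" for x
      using t(2)[of x] t(1) that by (simp add: abs_mult)
    then have g: "0 \<le> g x" "g x \<le> 2" for x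
      by (auto simp: g_def abs_le_iff) (smt (verit))+
    have int: "integrable M g" "(\<integral>x. g x \<partial>M) = 1"
      using intgr mean M.prob_space by (simp_all add: g_def)
    have "density M g \<in> prob_measures"
      using M g int by (intro prob_measures_density) auto
    moreover have "d_inf M (density M g) \<le> ennreal (2 * r)"
      using M g int outside pos by (intro d_inf_density_le[where a = a]) (auto simp: g_def)
    ultimately have "energy W M \<le> energy W (density M g)"
      by (rule min)
    then show ?thesis
      using energy_density[of g 2] g by (simp add: energy_eq_interaction g_def)
  qed
  have "2 * interaction W M (\<lambda>_. 1) (\<lambda>_. 1)
      \<le> 2 * interaction W M (\<lambda>_. 1) (\<lambda>_. 1) + 2 * t\<^sup>2 * interaction W M h h"
    using step[of t] step[of "- t"] t(1)
      interaction_affine[of h b t, OF _ h] interaction_affine[of h b "- t", OF _ h]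
    by (simp add: algebra_simps)
  then have "0 \<le> t\<^sup>2 * interaction W M h h"
    by simp
  then show ?thesis
    using t(1) by (simp add: zero_le_mult_iff)
qed

text \<open>
  For probability densities \<open>u\<close> and \<open>v\<close> the form is an average of the values of the kernel
  between their supports.
\<close>

lemma interaction_between_bounds:
  assumes [measurable]: "u \<in> borel_measurable borel" "v \<in> borel_measurable borel"
    and u: "\<And>x. 0 \<le> u x" "\<And>x. u x \<le> a" "(\<integral>x. u x \<partial>M) = 1"
    and v: "\<And>x. 0 \<le> v x" "\<And>x. v x \<le> b" "(\<integral>x. v x \<partial>M) = 1"
    and W: "\<And>x y. u x \<noteq> 0 \<Longrightarrow> v y \<noteq> 0 \<Longrightarrow> \<bar>W (y - x) - c\<bar> \<le> \<eta>"
  shows "\<bar>interaction W M u v - c\<bar> \<le> \<eta>"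
proof -
  have ub: "\<bar>u x\<bar> \<le> a" and vb: "\<bar>v x\<bar> \<le> b" for x
    using u v by auto
  note ten = integral_tensor[of u v a b, OF _ _ ub vb]
  have int: "integrable (M \<Otimes>\<^sub>M M) (\<lambda>z. u (fst z) * v (snd z) * W (snd z - fst z))"
    by (rule integrable_interaction[of u v a b, OF _ _ ub vb]) auto
  have "interaction W M u v - c = (\<integral>z. u (fst z) * v (snd z) * W (snd z - fst z)
      - u (fst z) * v (snd z) * c \<partial>(M \<Otimes>\<^sub>M M))"
    unfolding interaction_def using int ten u v
    by (subst Bochner_Integration.integral_diff) auto
  also have "\<bar>\<dots>\<bar> \<le> (\<integral>z. u (fst z) * v (snd z) * \<eta> \<partial>(M \<Otimes>\<^sub>M M))"
    unfolding real_norm_def[symmetric]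
  proof (rule Bochner_Integration.integral_norm_bound_integral)
    fix z
    have "\<bar>u (fst z) * v (snd z) * (W (snd z - fst z) - c)\<bar> \<le> u (fst z) * v (snd z) * \<eta>"
    proof (cases "u (fst z) = 0 \<or> v (snd z) = 0")
      case False
      then show ?thesis
        using W[of "fst z" "snd z"] u v by (auto simp: abs_mult intro!: mult_left_mono)
    qed auto
    then show "norm (u (fst z) * v (snd z) * W (snd z - fst z) - u (fst z) * v (snd z) * c)
        \<le> u (fst z) * v (snd z) * \<eta>"
      by (simp add: algebra_simps)
  qed (use int ten in auto)
  also have "\<dots> = \<eta>"
    using ten u v by simp
  finally show ?thesis .
qed

lemma interaction_sum:
  assumes "finite I" and [measurable]: "\<And>i. u i \<in> borel_measurable borel"
    and u: "\<And>i x. \<bar>u i x\<bar> \<le> b i"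
  shows "interaction W M (\<lambda>x. \<Sum>i\<in>I. c i * u i x) (\<lambda>x. \<Sum>i\<in>I. c i * u i x)
       = (\<Sum>i\<in>I. \<Sum>j\<in>I. c i * c j * interaction W M (u i) (u j))"
proof -
  have int: "integrable (M \<Otimes>\<^sub>M M) (\<lambda>z. u i (fst z) * u j (snd z) * W (snd z - fst z))" for i j
    by (rule integrable_interaction[where a = "b i" and b = "b j"]) (use u in auto)
  have "(\<Sum>i\<in>I. c i * u i (fst z)) * (\<Sum>i\<in>I. c i * u i (snd z)) * W (snd z - fst z)
      = (\<Sum>i\<in>I. \<Sum>j\<in>I. c i * c j * (u i (fst z) * u j (snd z) * W (snd z - fst z)))" for z
    unfolding sum_product sum_distrib_right by (simp add: sum_distrib_left mult_ac)
  then show ?thesis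
    unfolding interaction_def using int by simp
qed

text \<open>
  Balls around support points have positive mass, so the point masses \<open>c i\<close> at \<open>p i\<close>
  can be approximated by densities with respect to \<open>M\<close>: the normalised indicators \<open>u s i\<close>
  of balls of radius \<open>s\<close>. The second variation is nonnegative for each small \<open>s\<close>,
  and the limit \<open>s \<rightarrow> 0\<close> gives the claim since the kernel is continuous.
\<close>

theorem kernel_conditionally_nonneg_on_supp:
  assumes cont: "continuous_on UNIV W"
    and "finite I" and p: "\<And>i. i \<in> I \<Longrightarrow> p i \<in> supp M \<inter> ball a r" and c: "(\<Sum>i\<in>I. c i) = 0"
    and min: "\<And>\<nu>. \<nu> \<in> prob_measures \<Longrightarrow> d_inf M \<nu> \<le> ennreal (2 * r) \<Longrightarrow> energy W M \<le> energy W \<nu>"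
  shows "0 \<le> (\<Sum>i\<in>I. \<Sum>j\<in>I. c i * c j * W (p j - p i))"
proof (cases "I = {}")
  case False
  then have pos: "0 < measure M (ball a r)"
    using p by (metis IntE M all_not_in_conv measure_pos_if_supp open_ball)
  define m where "m = (\<lambda>i s. measure M (ball (p i) s))"
  define u where "u = (\<lambda>s i x. (indicator (ball (p i) s) x / m i s :: real))"
  have [measurable]: "u s i \<in> borel_measurable borel" for s i
    unfolding u_def by (intro borel_measurable_divide borel_measurable_indicator) auto
  have u: "0 \<le> u s i x" "u s i x \<le> 1 / m i s" for s i x
    by (auto simp: u_def m_def indicator_def divide_nonneg_nonneg)
  have u1: "(\<integral>x. u s i x \<partial>M) = 1" if "i \<in> I" "0 < s" for s i
  proof -
    have "0 < m i s"
      unfolding m_def using p[OF that(1)] that(2) M by (intro measure_pos_if_supp) auto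
    then show ?thesis
      by (simp add: u_def m_def sets_M)
  qed
  have "((\<lambda>s. interaction W M (u s i) (u s j)) \<longlongrightarrow> W (p j - p i)) (at_right 0)"
    if "i \<in> I" "j \<in> I" for i j
  proof (rule tendstoI)
    fix e :: real assume "0 < e"
    then obtain d where d: "0 < d" "\<And>x. dist x (p j - p i) < d \<Longrightarrow> dist (W x) (W (p j - p i)) < e / 2"
      using cont unfolding continuous_on_iff by (meson UNIV_I half_gt_zero)
    have "dist (interaction W M (u s i) (u s j)) (W (p j - p i)) < e" if s: "0 < s" "s < d / 2" for s
    proof -
      have "\<bar>interaction W M (u s i) (u s j) - W (p j - p i)\<bar> \<le> e / 2"
      proof (rule interaction_between_bounds)
        fix x y assume "u s i x \<noteq> 0" "u s j y \<noteq> 0"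
        then have "dist (p i) x < s" "dist (p j) y < s"
          by (auto simp: u_def indicator_def split: if_splits)
        then have "dist (y - x) (p j - p i) < d"
          using s norm_triangle_ineq4[of "y - p j" "x - p i"]
          by (simp add: dist_norm norm_minus_commute algebra_simps)
        then show "\<bar>W (y - x) - W (p j - p i)\<bar> \<le> e / 2"
          using d(2)[of "y - x"] by (simp add: dist_real_def)
      qed (use u u1 \<open>i \<in> I\<close> \<open>j \<in> I\<close> s in auto)
      then show ?thesis
        using \<open>0 < e\<close> by (simp add: dist_real_def)
    qed
    then show "\<forall>\<^sub>F s in at_right 0. dist (interaction W M (u s i) (u s j)) (W (p j - p i)) < e"
      using d(1) by (auto simp: eventually_at_right_field intro!: exI[of _ "d / 2"])
  qed
  then have lim: "((\<lambda>s. \<Sum>i\<in>I. \<Sum>j\<in>I. c i * c j * interaction W M (u s i) (u s j))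
      \<longlongrightarrow> (\<Sum>i\<in>I. \<Sum>j\<in>I. c i * c j * W (p j - p i))) (at_right 0)"
    by (intro tendsto_sum tendsto_mult_left) auto
  have "\<forall>i\<in>I. \<exists>d>0. ball (p i) d \<subseteq> ball a r"
    using p by (meson IntE open_ball openE)
  then obtain d where d: "\<And>i. i \<in> I \<Longrightarrow> 0 < d i" "\<And>i. i \<in> I \<Longrightarrow> ball (p i) (d i) \<subseteq> ball a r"
    by metis
  have "\<forall>\<^sub>F s in at_right 0. \<forall>i\<in>I. s < d i"
    using \<open>finite I\<close> d(1) by (intro eventually_ball_finite ballI) (auto simp: eventually_at_right_field)
  moreover have "\<forall>\<^sub>F s in at_right 0. (0::real) < s"
    by (rule eventually_at_right_less)
  ultimately have "\<forall>\<^sub>F s in at_right 0. 0 \<le> (\<Sum>i\<in>I. \<Sum>j\<in>I. c i * c j * interaction W M (u s i) (u s j))"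
  proof eventually_elim
    case (elim s)
    define h where "h = (\<lambda>x. \<Sum>i\<in>I. c i * u s i x)"
    have "0 \<le> interaction W M h h"
    proof (rule second_variation_nonneg[OF _ _ _ _ pos min])
      show "\<bar>h x\<bar> \<le> (\<Sum>i\<in>I. \<bar>c i\<bar> * (1 / m i s))" for x
        unfolding h_def using u
        by (intro order_trans[OF sum_abs] sum_mono) (simp only: abs_mult abs_of_nonneg mult_left_mono abs_ge_zero)
      show "h x = 0" if "x \<notin> ball a r" for x
      proof -
        have "u s i x = 0" if "i \<in> I" for i
          using d(2)[OF that] elim that \<open>x \<notin> ball a r\<close> by (force simp: u_def indicator_def)
        then show ?thesis
          by (simp add: h_def)
      qed
      have "integrable M (u s i)" for i
        using u by (intro integrable_bounded[where b = "1 / m i s"]) auto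
      then show "(\<integral>x. h x \<partial>M) = 0"
        using c u1 elim by (simp add: h_def)
    qed (simp_all add: h_def)
    moreover have "interaction W M h h = (\<Sum>i\<in>I. \<Sum>j\<in>I. c i * c j * interaction W M (u s i) (u s j))"
      unfolding h_def using u \<open>finite I\<close> by (intro interaction_sum[where b = "\<lambda>i. 1 / m i s"]) auto
    ultimately show ?case
      by simp
  qed
  then show ?thesis
    using lim by (intro tendsto_lowerbound[OF lim]) auto
qed simp

text \<open>
  The weights \<open>- b - c\<close>, \<open>b\<close>, \<open>c\<close> at \<open>x\<close>, \<open>y\<close>, \<open>z\<close> turn conditional
  nonnegativity into nonnegativity of a binary quadratic form in \<open>b\<close> and \<open>c\<close>, and the
  inequality says that its discriminant is not positive.
\<close>

lemma three_point_inequality: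
  assumes cont: "continuous_on UNIV W" and W0: "W 0 = 0" and even: "\<And>x. W (- x) = W x"
    and supp: "x \<in> supp M \<inter> ball a r" "y \<in> supp M \<inter> ball a r" "z \<in> supp M \<inter> ball a r"
    and min: "\<And>\<nu>. \<nu> \<in> prob_measures \<Longrightarrow> d_inf M \<nu> \<le> ennreal (2 * r) \<Longrightarrow> energy W M \<le> energy W \<nu>"
    and neg: "W (y - x) < 0"
  shows "(W (z - y) - W (y - x) - W (z - x))\<^sup>2 \<le> 4 * W (y - x) * W (z - x)"
proof -
  define A B D where "A = - W (y - x)" and "B = W (z - y) - W (y - x) - W (z - x)" and "D = - W (z - x)"
  define p where "p = (\<lambda>i::nat. if i = 0 then x else if i = 1 then y else z)"
  have quad: "0 \<le> A * b\<^sup>2 + B * b * c + D * c\<^sup>2" for b c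
  proof -
    define k where "k = (\<lambda>i::nat. if i = 0 then - b - c else if i = 1 then b else c)"
    have "0 \<le> (\<Sum>i\<in>{0, 1, 2}. \<Sum>j\<in>{0, 1, 2}. k i * k j * W (p j - p i))"
    proof (rule kernel_conditionally_nonneg_on_supp[OF cont _ _ _ min])
      show "p i \<in> supp M \<inter> ball a r" for i
        using supp by (simp add: p_def)
    qed (simp_all add: k_def)
    also have "\<dots> = 2 * (A * b\<^sup>2 + B * b * c + D * c\<^sup>2)"
      using even[of "y - x"] even[of "z - x"] even[of "z - y"] W0
      by (simp add: k_def p_def A_def B_def D_def algebra_simps power2_eq_square)
    finally show ?thesis
      by simp
  qed
  \<comment> \<open>For \<open>c = 2 A\<close> the form is minimal at \<open>b = - B\<close>.\<close>
  have "A * (- B)\<^sup>2 + B * (- B) * (2 * A) + D * (2 * A)\<^sup>2 = A * (4 * A * D - B\<^sup>2)"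
    by (simp add: algebra_simps power2_eq_square)
  with quad[of "- B" "2 * A"] have "0 \<le> A * (4 * A * D - B\<^sup>2)"
    by simp
  moreover have "0 < A"
    using neg by (simp add: A_def)
  ultimately have "B\<^sup>2 \<le> 4 * A * D"
    by (simp add: zero_le_mult_iff)
  then show ?thesis
    by (simp add: A_def B_def D_def)
qed

end

section \<open>Radial kernels\<close>

lemma radial_profile_has_derivative:
  fixes W :: "'a::euclidean_space \<Rightarrow> real"
  assumes radial: "\<And>x. W x = w (norm x)" and diff: "\<And>x. W differentiable (at x)" and "0 < r"
  shows "(w has_real_derivative deriv w r) (at r)"
proof -
  obtain u :: 'a where u: "norm u = 1"
    using nonempty_Basis norm_Basis by blast
  have "(\<lambda>s. W (s *\<^sub>R u)) differentiable (at r)"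
    by (rule differentiable_compose[of W], rule diff) (auto intro!: derivative_intros)
  then have "w differentiable (at r)"
  proof (rule differentiable_transform_within)
    fix s assume "dist s r < r"
    then have "0 < s"
      by (simp add: dist_real_def)
    then show "W (s *\<^sub>R u) = w s"
      by (simp add: radial u)
  qed (use \<open>0 < r\<close> in auto)
  then show ?thesis
    by (simp add: DERIV_deriv_iff_real_differentiable)
qed

lemma radial_has_derivative:
  fixes W :: "'a::euclidean_space \<Rightarrow> real"
  assumes radial: "\<And>x. W x = w (norm x)" and diff: "\<And>x. W differentiable (at x)" and "v \<noteq> 0"
  shows "(W has_derivative (\<lambda>h. (sgn v \<bullet> h) * deriv w (norm v))) (at v)"
proof -
  have "(w has_derivative (*) (deriv w (norm v))) (at (norm v))"
    using radial_profile_has_derivative[OF radial diff, of "norm v"] \<open>v \<noteq> 0\<close>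
    by (simp add: has_field_derivative_def)
  from has_derivative_compose[OF has_derivative_norm[OF \<open>v \<noteq> 0\<close>] this]
  have "((\<lambda>x. w (norm x)) has_derivative (\<lambda>h. (sgn v \<bullet> h) * deriv w (norm v))) (at v)"
    by (simp add: inner_commute mult.commute)
  moreover have "W = (\<lambda>x. w (norm x))"
    by (rule ext) (rule radial)
  ultimately show ?thesis
    by simp
qed

lemma deriv_profile_bounds:
  fixes w :: "real \<Rightarrow> real"
  assumes "0 < C" and lim: "((\<lambda>r. deriv w r * r powr (1 - \<alpha>)) \<longlongrightarrow> - C) (at_right 0)"
  obtains d where "0 < d" "\<And>r. 0 < r \<Longrightarrow> r < d \<Longrightarrow> deriv w r < 0"
    "\<And>r. 0 < r \<Longrightarrow> r < d \<Longrightarrow> \<bar>deriv w r\<bar> \<le> 2 * C * r powr (\<alpha> - 1)"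
proof -
  have "\<forall>\<^sub>F r in at_right 0. dist (deriv w r * r powr (1 - \<alpha>)) (- C) < C"
    using lim \<open>0 < C\<close> by (rule tendstoD)
  then obtain d where d: "0 < d" "\<And>r. 0 < r \<Longrightarrow> r < d \<Longrightarrow> \<bar>deriv w r * r powr (1 - \<alpha>) + C\<bar> < C"
    by (auto simp: eventually_at_right_field dist_real_def)
  have *: "deriv w r = (deriv w r * r powr (1 - \<alpha>)) * r powr (\<alpha> - 1)" if "0 < r" for r
    using that by (simp add: mult.assoc powr_add[symmetric])
  show thesis
  proof (rule that[OF d(1)])
    fix r assume r: "0 < r" "r < d"
    then have q: "- (2 * C) < deriv w r * r powr (1 - \<alpha>)" "deriv w r * r powr (1 - \<alpha>) < 0"
      using d(2)[OF r] by linarith+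
    show "deriv w r < 0"
      using q(2) r by (simp add: mult_less_0_iff)
    have "\<bar>deriv w r\<bar> = \<bar>deriv w r * r powr (1 - \<alpha>)\<bar> * r powr (\<alpha> - 1)"
      by (subst *[OF r(1)]) (simp add: abs_mult)
    also have "\<dots> \<le> 2 * C * r powr (\<alpha> - 1)"
      using q by (intro mult_right_mono) auto
    finally show "\<bar>deriv w r\<bar> \<le> 2 * C * r powr (\<alpha> - 1)" .
  qed
qed

text \<open>
  By the mean value theorem and the bound on the derivative of the profile, \<open>W x\<close> is at most of
  order \<open>|x|\<^sup>\<alpha>\<close>. The exponent \<open>\<alpha> > 2\<close> enters the proof only here.
\<close>

lemma radial_kernel_subquadratic:
  fixes W :: "'a::euclidean_space \<Rightarrow> real"
  assumes radial: "\<And>x. W x = w (norm x)" and diff: "\<And>x. W differentiable (at x)"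
    and W0: "W 0 = 0" and "0 < C" "2 < \<alpha>"
    and lim: "((\<lambda>r. deriv w r * r powr (1 - \<alpha>)) \<longlongrightarrow> - C) (at_right 0)"
  shows "((\<lambda>x. W x / (norm x)\<^sup>2) \<longlongrightarrow> 0) (at 0)"
proof -
  obtain d where d: "0 < d" "\<And>r. 0 < r \<Longrightarrow> r < d \<Longrightarrow> \<bar>deriv w r\<bar> \<le> 2 * C * r powr (\<alpha> - 1)"
    using deriv_profile_bounds[OF \<open>0 < C\<close> lim] by metis
  obtain u :: 'a where u: "norm u = 1"
    using nonempty_Basis norm_Basis by blast
  have bound: "\<bar>W x\<bar> / (norm x)\<^sup>2 \<le> 2 * C * norm x powr (\<alpha> - 2)" if "x \<noteq> 0" "norm x < d" for x
  proof -
    let ?r = "norm x"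
    have "continuous_on UNIV W"
      using diff by (simp add: continuous_at_imp_continuous_on differentiable_imp_continuous_within)
    then have "continuous_on {0..?r} (\<lambda>s. W (s *\<^sub>R u))"
      by (rule continuous_on_compose2) (auto intro!: continuous_intros)
    then have "continuous_on {0..?r} w"
      by (rule continuous_on_eq) (auto simp: radial u)
    then obtain l z where z: "0 < z" "z < ?r" "DERIV w z :> l" "w ?r - w 0 = (?r - 0) * l"
      using MVT[of 0 ?r w] differentiableI[OF has_field_derivative_imp_has_derivative[OF
            radial_profile_has_derivative[OF radial diff]]] \<open>x \<noteq> 0\<close> by auto
    have "\<bar>W x\<bar> = ?r * \<bar>deriv w z\<bar>"
      using z(3,4) W0 radial[of x] radial[of 0] by (simp add: DERIV_imp_deriv abs_mult)
    also have "\<dots> \<le> ?r * (2 * C * z powr (\<alpha> - 1))"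
      using d(2)[of z] z that by (intro mult_left_mono) auto
    also have "\<dots> \<le> ?r * (2 * C * ?r powr (\<alpha> - 1))"
      using z \<open>0 < C\<close> \<open>2 < \<alpha>\<close> by (intro mult_left_mono powr_mono2) auto
    also have "\<dots> = 2 * C * ?r powr (\<alpha> - 2) * ?r\<^sup>2"
    proof -
      have "?r powr (\<alpha> - 1) = ?r powr (\<alpha> - 2) * ?r"
        using \<open>x \<noteq> 0\<close> powr_add[of ?r "\<alpha> - 2" 1] by simp
      then show ?thesis
        by (simp add: power2_eq_square)
    qed
    finally show ?thesis
      using \<open>x \<noteq> 0\<close> by (simp add: divide_le_eq)
  qed
  have "((\<lambda>x::'a. norm x powr (\<alpha> - 2)) \<longlongrightarrow> 0) (at 0)"
    using \<open>2 < \<alpha>\<close> tendsto_norm[OF tendsto_ident_at[of "0::'a" UNIV]]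
    by (intro tendsto_zero_powrI[where b = "\<alpha> - 2"]) (auto intro: tendsto_eq_intros)
  then have "((\<lambda>x::'a. 2 * C * norm x powr (\<alpha> - 2)) \<longlongrightarrow> 0) (at 0)"
    by (rule tendsto_mult_right_zero)
  moreover have "\<forall>\<^sub>F x::'a in at 0. norm (W x / (norm x)\<^sup>2) \<le> 2 * C * norm x powr (\<alpha> - 2)"
    using bound d(1) by (auto simp: eventually_at dist_norm intro!: exI[of _ d])
  ultimately show ?thesis
    by (rule Lim_null_comparison[rotated])
qed

section \<open>Support points are isolated\<close>

lemma has_derivative_along_sequence:
  fixes f :: "'a::real_normed_vector \<Rightarrow> 'b::real_normed_vector"
  assumes D: "(f has_derivative D) (at v)"
    and h: "h \<longlonglongrightarrow> 0" "\<And>k. h k \<noteq> 0" and e: "(\<lambda>k. sgn (h k)) \<longlonglongrightarrow> e"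
  shows "(\<lambda>k. (f (v + h k) - f v) /\<^sub>R norm (h k)) \<longlonglongrightarrow> D e"
proof -
  interpret D: bounded_linear D
    using D by (rule has_derivative_bounded_linear)
  have "filterlim h (at 0) sequentially"
    using h by (auto simp: filterlim_at)
  moreover have "((\<lambda>h. norm (f (v + h) - f v - D h) / norm h) \<longlongrightarrow> 0) (at 0)"
    using D by (simp add: has_derivative_at)
  ultimately have "(\<lambda>k. norm (f (v + h k) - f v - D (h k)) / norm (h k)) \<longlonglongrightarrow> 0"
    by (rule filterlim_compose[rotated])
  then have "(\<lambda>k. (f (v + h k) - f v - D (h k)) /\<^sub>R norm (h k)) \<longlonglongrightarrow> 0"
    by (subst tendsto_norm_zero_iff[symmetric]) (simp add: divide_inverse mult.commute)
  from tendsto_add[OF this D.tendsto[OF e]]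
  show ?thesis
    by (simp add: sgn_div_norm D.scaleR scaleR_diff_right)
qed

text \<open>
  Divide the three point inequality by the square of \<open>\<rho> k = |X k - x|\<close>. On the left
  \<open>(W (z - X k) - W (z - x)) / \<rho> k\<close> is a difference quotient, with limit \<open>- D e\<close>; the other
  term there and the right side vanish in the limit because \<open>W\<close> is subquadratic at 0.
\<close>

lemma accumulation_direction_in_kernel_of_derivative:
  fixes W :: "'a::euclidean_space \<Rightarrow> real"
  assumes three: "\<And>k. (W (z - X k) - W (X k - x) - W (z - x))\<^sup>2 \<le> 4 * W (X k - x) * W (z - x)"
    and D: "(W has_derivative D) (at (z - x))"
    and small: "((\<lambda>v. W v / (norm v)\<^sup>2) \<longlongrightarrow> 0) (at 0)"
    and X: "X \<longlonglongrightarrow> x" "\<And>k. X k \<noteq> x" and e: "(\<lambda>k. sgn (X k - x)) \<longlonglongrightarrow> e"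
  shows "D e = 0"
proof -
  interpret D: bounded_linear D
    using D by (rule has_derivative_bounded_linear)
  define \<rho> where "\<rho> = (\<lambda>k. norm (X k - x))"
  have pos: "0 < \<rho> k" for k
    using X(2) by (simp add: \<rho>_def)
  have X0: "(\<lambda>k. X k - x) \<longlonglongrightarrow> 0"
    using X(1) by (simp add: LIM_zero_iff)
  then have \<rho>0: "\<rho> \<longlonglongrightarrow> 0"
    unfolding \<rho>_def by (rule tendsto_norm_zero)
  have "filterlim (\<lambda>k. X k - x) (at 0) sequentially"
    using X0 X(2) by (auto simp: filterlim_at)
  from filterlim_compose[OF small this]
  have q: "(\<lambda>k. W (X k - x) / (\<rho> k)\<^sup>2) \<longlonglongrightarrow> 0"
    by (simp add: \<rho>_def)
  from tendsto_mult[OF this \<rho>0]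
  have l: "(\<lambda>k. W (X k - x) / \<rho> k) \<longlonglongrightarrow> 0"
    using pos by (simp add: power2_eq_square less_imp_neq[THEN not_sym])
  have "(\<lambda>k. (W ((z - x) + (x - X k)) - W (z - x)) /\<^sub>R norm (x - X k)) \<longlonglongrightarrow> D (- e)"
  proof (rule has_derivative_along_sequence[OF D])
    show "(\<lambda>k. x - X k) \<longlonglongrightarrow> 0"
      using tendsto_minus[OF X0] by simp
    show "(\<lambda>k. sgn (x - X k)) \<longlonglongrightarrow> - e"
      using tendsto_minus[OF e] by (simp flip: sgn_minus)
    show "x - X k \<noteq> 0" for k
      by (metis X(2) right_minus_eq)
  qed
  then have "(\<lambda>k. (W (z - X k) - W (z - x)) / \<rho> k) \<longlonglongrightarrow> D (- e)"
    by (simp add: \<rho>_def norm_minus_commute divide_inverse mult.commute)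
  from tendsto_power[OF tendsto_diff[OF this l], of 2]
  have left: "(\<lambda>k. ((W (z - X k) - W (z - x)) / \<rho> k - W (X k - x) / \<rho> k)\<^sup>2) \<longlonglongrightarrow> (D e)\<^sup>2"
    by (simp add: D.neg)
  have right: "(\<lambda>k. 4 * (W (X k - x) / (\<rho> k)\<^sup>2) * W (z - x)) \<longlonglongrightarrow> 0"
    using tendsto_mult[OF tendsto_mult[OF tendsto_const q], of "\<lambda>_. W (z - x)" "W (z - x)" 4] by simp
  have "((W (z - X k) - W (z - x)) / \<rho> k - W (X k - x) / \<rho> k)\<^sup>2
      \<le> 4 * (W (X k - x) / (\<rho> k)\<^sup>2) * W (z - x)" for k
  proof -
    have "((W (z - X k) - W (z - x)) / \<rho> k - W (X k - x) / \<rho> k)\<^sup>2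
        = (W (z - X k) - W (X k - x) - W (z - x))\<^sup>2 / (\<rho> k)\<^sup>2"
      by (simp add: diff_divide_distrib[symmetric] power_divide algebra_simps)
    also have "\<dots> \<le> 4 * W (X k - x) * W (z - x) / (\<rho> k)\<^sup>2"
      using three by (intro divide_right_mono) auto
    finally show ?thesis
      by simp
  qed
  then have "(D e)\<^sup>2 \<le> 0"
    by (intro LIMSEQ_le[OF left right]) auto
  then show ?thesis
    by simp
qed

text \<open>
  Accumulating support points may be assumed to approach \<open>x\<close> in a direction \<open>e\<close>, by
  compactness of the sphere. Each of them also serves as the fixed third point \<open>z\<close> of the
  previous lemma, so all of them lie orthogonally to \<open>e\<close>, the limit of their own directions.
\<close>

lemma (in finite_energy_measure) supp_point_isolated:
  assumes radial: "\<And>x. W x = w (norm x)" and diff: "\<And>x. W differentiable (at x)"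
    and W0: "W 0 = 0" and "0 < R" and neg: "\<And>x. 0 < norm x \<Longrightarrow> norm x < R \<Longrightarrow> W x < 0"
    and \<alpha>: "2 < \<alpha>" and C: "0 < C"
    and lim: "((\<lambda>r. deriv w r * r powr (1 - \<alpha>)) \<longlongrightarrow> - C) (at_right 0)"
    and "0 < r"
    and min: "\<And>\<nu>. \<nu> \<in> prob_measures \<Longrightarrow> d_inf M \<nu> \<le> ennreal (2 * r) \<Longrightarrow> energy W M \<le> energy W \<nu>"
    and x: "x \<in> supp M"
  shows "x isolated_in supp M"
proof (rule ccontr)
  assume "\<not> x isolated_in supp M"
  then have "x islimpt supp M"
    using x by (simp add: isolated_in_islimpt_iff)
  have cont: "continuous_on UNIV W"
    using diff by (simp add: continuous_at_imp_continuous_on differentiable_imp_continuous_within)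
  obtain d where d: "0 < d" "\<And>r. 0 < r \<Longrightarrow> r < d \<Longrightarrow> deriv w r < 0"
    using deriv_profile_bounds[OF C lim] by metis
  define \<delta> where "\<delta> = min r (min R d)"
  have \<delta>: "0 < \<delta>" "\<delta> \<le> r" "\<delta> \<le> R" "\<delta> \<le> d"
    using \<open>0 < r\<close> \<open>0 < R\<close> d by (auto simp: \<delta>_def)
  have "x islimpt (supp M \<inter> ball x \<delta>)"
    using \<open>x islimpt supp M\<close> \<delta>(1)
    by (intro islimpt_Int_eventually eventually_at_in_open') auto
  then obtain X where X: "\<And>k. X k \<in> supp M \<inter> ball x \<delta> - {x}" "X \<longlonglongrightarrow> x"
    unfolding islimpt_sequential by blast
  have "sgn (X k - x) \<in> sphere 0 1" for k
    using X(1)[of k] by (simp add: norm_sgn)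
  then obtain e \<phi> where e: "norm e = 1" "strict_mono \<phi>" "((\<lambda>k. sgn (X k - x)) \<circ> \<phi>) \<longlonglongrightarrow> e"
    using compact_sphere[of "0::'a" 1] unfolding compact_def by (metis mem_sphere_0)
  define Y where "Y = X \<circ> \<phi>"
  have Y: "Y k \<in> supp M" "Y k \<in> ball x \<delta>" "Y k \<noteq> x" for k
    using X(1) by (auto simp: Y_def)
  have Yx: "Y \<longlonglongrightarrow> x"
    unfolding Y_def using X(2) e(2) by (rule LIMSEQ_subseq_LIMSEQ)
  have Ye: "(\<lambda>k. sgn (Y k - x)) \<longlonglongrightarrow> e"
    using e(3) by (simp add: Y_def o_def)
  have norm_Y: "0 < norm (Y k - x)" "norm (Y k - x) < \<delta>" for k
    using Y[of k] by (auto simp: dist_norm norm_minus_commute)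
  have "sgn (Y j - x) \<bullet> e = 0" for j
  proof -
    have "(sgn (Y j - x) \<bullet> e) * deriv w (norm (Y j - x)) = 0"
    proof (rule accumulation_direction_in_kernel_of_derivative[OF _ _ _ Yx _ Ye])
      show "(W (Y j - Y k) - W (Y k - x) - W (Y j - x))\<^sup>2 \<le> 4 * W (Y k - x) * W (Y j - x)" for k
      proof (rule three_point_inequality[OF cont W0 _ _ _ _ min])
        show "x \<in> supp M \<inter> ball x r" "Y k \<in> supp M \<inter> ball x r" "Y j \<in> supp M \<inter> ball x r"
          using x Y[of j] Y[of k] \<delta> by auto
        show "W (Y k - x) < 0"
          using norm_Y[of k] \<delta> by (intro neg) auto
      qed (auto simp: radial)
      show "(W has_derivative (\<lambda>h. (sgn (Y j - x) \<bullet> h) * deriv w (norm (Y j - x)))) (at (Y j - x))"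
        using Y(3)[of j] by (intro radial_has_derivative[OF radial diff]) auto
      show "((\<lambda>v. W v / (norm v)\<^sup>2) \<longlongrightarrow> 0) (at 0)"
        by (rule radial_kernel_subquadratic[OF radial diff W0 C \<alpha> lim])
    qed (use Y in auto)
    moreover have "deriv w (norm (Y j - x)) < 0"
      using norm_Y[of j] \<delta> by (intro d) auto
    ultimately show ?thesis
      by simp
  qed
  then have "e \<bullet> e = 0"
    using tendsto_inner[OF Ye tendsto_const[of e]] by (simp add: LIMSEQ_const_iff)
  then show False
    using e(1) by simp
qed

section \<open>The support of a global minimizer is bounded\<close>

text \<open>The witness consists of two equal masses at \<open>0\<close> and \<open>v\<close>.\<close>

lemma exists_negative_energy:
  fixes W :: "'a::euclidean_space \<Rightarrow> real"
  assumes [measurable]: "W \<in> borel_measurable borel" and W0: "W 0 = 0"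
    and neg: "W v < 0" "W (- v) < 0"
  shows "\<exists>\<nu>\<in>prob_measures. energy W \<nu> < 0"
proof -
  have v: "v \<noteq> 0"
    using W0 neg by auto
  define p where "p = pmf_of_set {0, v}"
  define \<nu> where "\<nu> = distr (measure_pmf p) borel id"
  have set_p: "set_pmf p = {0, v}"
    by (simp add: p_def)
  have int: "integrable \<nu> f" and eq: "(\<integral>x. f x \<partial>\<nu>) = (f 0 + f v) / 2"
    if [measurable]: "f \<in> borel_measurable borel" for f :: "'a \<Rightarrow> real"
  proof -
    show "integrable \<nu> f"
      unfolding \<nu>_def by (subst integrable_distr_eq) (auto intro!: integrable_measure_pmf_finite simp: set_p)
    have "(\<integral>x. f x \<partial>\<nu>) = measure_pmf.expectation p f"
      unfolding \<nu>_def by (subst integral_distr) auto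
    then show "(\<integral>x. f x \<partial>\<nu>) = (f 0 + f v) / 2"
      using v by (simp add: p_def integral_pmf_of_set)
  qed
  have inner: "(\<integral>x. W (x - y) \<partial>\<nu>) = (W (0 - y) + W (v - y)) / 2" for y
    by (rule eq) measurable
  have "prob_space \<nu>"
    unfolding \<nu>_def by (intro measure_pmf.prob_space_distr) simp
  then have "\<nu> \<in> prob_measures"
    by (simp add: prob_measures_def \<nu>_def)
  moreover have "energy W \<nu> = ereal (1/2 * (\<integral>y. \<integral>x. W (x - y) \<partial>\<nu> \<partial>\<nu>))"
  proof (rule energy_eq_iterated_integral)
    show "integrable \<nu> (\<lambda>y. \<integral>x. W (x - y) \<partial>\<nu>)"
      unfolding inner by (rule int) measurable
  qed (auto intro!: int)
  moreover have "(\<integral>y. \<integral>x. W (x - y) \<partial>\<nu> \<partial>\<nu>) < 0"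
    unfolding inner by (subst eq) (use W0 neg in auto)
  ultimately show ?thesis
    by (intro bexI[of _ \<nu>]) auto
qed

context finite_energy_measure
begin

text \<open>
  The sets \<open>S\<close> and \<open>T\<close> localise the negative part: it lives on \<open>S \<times> T\<close>, where the weights
  are at most 1 and the kernel is at least \<open>- K\<close>.
\<close>

lemma interaction_ge:
  assumes [measurable]: "g \<in> borel_measurable borel" "h \<in> borel_measurable borel"
      "S \<in> sets borel" "T \<in> sets borel"
    and g: "\<And>x. 0 \<le> g x" "\<And>x. g x \<le> 1" and h: "\<And>x. 0 \<le> h x" "\<And>x. h x \<le> 1"
    and bound: "\<And>x. - K \<le> W x"
    and neg: "\<And>x y. g x * h y \<noteq> 0 \<Longrightarrow> W (y - x) < 0 \<Longrightarrow> x \<in> S \<and> y \<in> T"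
    and "0 \<le> K"
  shows "- K * (measure M S * measure M T) \<le> interaction W M g h"
proof -
  have ten: "integrable (M \<Otimes>\<^sub>M M) (\<lambda>z. indicat_real S (fst z) * indicat_real T (snd z))"
      "(\<integral>z. indicat_real S (fst z) * indicat_real T (snd z) \<partial>(M \<Otimes>\<^sub>M M)) = measure M S * measure M T"
    using integral_tensor[of "indicat_real S" "indicat_real T" 1 1] by (simp_all add: sets_M)
  have "- K * (measure M S * measure M T)
      = (\<integral>z. - K * (indicat_real S (fst z) * indicat_real T (snd z)) \<partial>(M \<Otimes>\<^sub>M M))"
    using ten by simp
  also have "\<dots> \<le> interaction W M g h"
    unfolding interaction_def
  proof (rule integral_mono)
    show "integrable (M \<Otimes>\<^sub>M M) (\<lambda>z. g (fst z) * h (snd z) * W (snd z - fst z))"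
      by (rule integrable_interaction[where a = 1 and b = 1]) (use g h in auto)
    fix z
    have gh: "0 \<le> g (fst z) * h (snd z)" "g (fst z) * h (snd z) \<le> 1"
      using g h by (auto intro: mult_le_one)
    show "- K * (indicat_real S (fst z) * indicat_real T (snd z))
        \<le> g (fst z) * h (snd z) * W (snd z - fst z)"
    proof (cases "g (fst z) * h (snd z) \<noteq> 0 \<and> W (snd z - fst z) < 0")
      case True
      then have "- K \<le> g (fst z) * h (snd z) * - K"
        using gh \<open>0 \<le> K\<close> mult_right_mono[OF gh(2) \<open>0 \<le> K\<close>] by simp
      also have "\<dots> \<le> g (fst z) * h (snd z) * W (snd z - fst z)"
        using gh bound by (intro mult_left_mono) auto
      finally show ?thesis
        using neg[of "fst z" "snd z"] True by simp
    next
      case False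
      then have "0 \<le> g (fst z) * h (snd z) * W (snd z - fst z)"
        using gh by (auto simp: not_less)
      moreover have "- K * (indicat_real S (fst z) * indicat_real T (snd z)) \<le> 0"
        using \<open>0 \<le> K\<close> by (simp add: indicator_def)
      ultimately show ?thesis
        by linarith
    qed
  qed (use ten in auto)
  finally show ?thesis .
qed

lemma interaction_rescale:
  "interaction W M (\<lambda>x. g x / c) (\<lambda>x. h x / c) = interaction W M g h / c\<^sup>2"
proof -
  have "g (fst z) / c * (h (snd z) / c) * W (snd z - fst z)
      = g (fst z) * h (snd z) * W (snd z - fst z) / c\<^sup>2" for z
    by (simp add: power2_eq_square)
  then show ?thesis
    unfolding interaction_def by (simp only: integral_divide_zero)
qed

text \<open>
  Let \<open>m\<close> be the mass of the ball \<open>A\<close> of radius \<open>R / 2\<close> around \<open>x\<close>, and compare with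
  the measure restricted to the complement of \<open>A\<close> and divided by \<open>1 - m\<close>. The self-interaction
  of \<open>A\<close> is not positive, as \<open>A\<close> has diameter \<open>R\<close>. Hence the interaction \<open>I\<close> of
  \<open>A\<close> with everything, counted in both orders, is at most
  \<open>J (2 m - m\<^sup>2) \<le> J m\<close> when \<open>J\<close>, twice the energy, is negative. On the other hand only
  points of the ball \<open>B\<close> of radius \<open>2 R\<close> attract \<open>A\<close>, so that \<open>I\<close> is at least
  \<open>- 2 K m\<close> times the mass of \<open>B\<close>. The factor \<open>m\<close> cancels. When \<open>m = 1\<close> there is no such
  competitor, but then \<open>B\<close> has full mass and the claim follows from \<open>- K \<le> J\<close>.
\<close>

lemma mass_near_supp_ge:
  assumes "0 < R" and neg: "\<And>x. norm x < R \<Longrightarrow> W x \<le> 0" and nonneg: "\<And>x. R \<le> norm x \<Longrightarrow> 0 \<le> W x"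
    and K: "0 < K" "\<And>x. - K \<le> W x"
    and min: "\<And>\<nu>. \<nu> \<in> prob_measures \<Longrightarrow> energy W M \<le> energy W \<nu>"
    and x: "x \<in> supp M"
  shows "- interaction W M (\<lambda>_. 1) (\<lambda>_. 1) / (2 * K) \<le> measure M (ball x (2 * R))"
proof -
  define A where "A = ball x (R / 2)"
  define B where "B = ball x (2 * R)"
  define m where "m = measure M A"
  define J where "J = interaction W M (\<lambda>_. 1) (\<lambda>_. 1)"
  have [measurable]: "A \<in> sets borel" "B \<in> sets borel"
    by (simp_all add: A_def B_def)
  have mB: "m \<le> measure M B"
    unfolding m_def by (rule M.finite_measure_mono) (use \<open>0 < R\<close> in \<open>auto simp: A_def B_def sets_M\<close>)
  have near: "y \<in> B" if "z \<in> A" "norm (y - z) < R" for y z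
    using that \<open>0 < R\<close> dist_triangle_less_add[of x z "R / 2" y R]
    by (auto simp: A_def B_def dist_norm norm_minus_commute)
  have "0 < m"
    unfolding m_def A_def using M x \<open>0 < R\<close> by (intro measure_pos_if_supp) auto
  have J: "- K \<le> J"
    using interaction_ge[of "\<lambda>_. 1" "\<lambda>_. 1" UNIV UNIV K] K M.prob_space by (simp add: J_def)
  show ?thesis
  proof (cases "m = 1")
    case True
    then have "K * 1 \<le> K * measure M B"
      using mB K by (intro mult_left_mono) auto
    then have "- J \<le> 2 * (K * measure M B)"
      using J K(1) by linarith
    then show ?thesis
      unfolding J_def[symmetric] B_def[symmetric]
      using K(1) by (subst pos_divide_le_eq) (auto simp: mult_ac)
  next
    case False
    then have "m < 1"
      using M.prob_le_1[of A] by (simp add: m_def order_less_le)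
    let ?h = "indicat_real A"
    define I where "I = interaction W M (\<lambda>_. 1) ?h + interaction W M ?h (\<lambda>_. 1)"
    define g where "g = (\<lambda>y. (1 + (- 1) * ?h y) / (1 - m))"
    have [measurable]: "g \<in> borel_measurable borel"
      by (simp add: g_def)
    have g: "0 \<le> g y" "g y \<le> 1 / (1 - m)" for y
      using \<open>m < 1\<close> by (auto simp: g_def indicator_def)
    have "integrable M ?h"
      by (rule integrable_bounded[where b = 1]) (auto simp: indicator_def)
    then have "(\<integral>y. g y \<partial>M) = 1"
      using M.prob_space \<open>m < 1\<close> by (simp add: g_def m_def sets_M)
    moreover have "integrable M g"
      by (rule integrable_bounded[where b = "1 / (1 - m)"]) (use g in auto)
    ultimately have "density M g \<in> prob_measures"
      using M g by (intro prob_measures_density) auto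
    then have "energy W M \<le> energy W (density M g)"
      by (rule min)
    then have "J \<le> interaction W M g g"
      using energy_density[of g "1 / (1 - m)"] g by (simp add: energy_eq_interaction J_def)
    also have "\<dots> = (J - I + interaction W M ?h ?h) / (1 - m)\<^sup>2"
      unfolding g_def interaction_rescale
      using interaction_affine[of ?h 1 "- 1"] by (simp add: indicator_def I_def J_def)
    finally have "J * (1 - m)\<^sup>2 \<le> J - I + interaction W M ?h ?h"
      using \<open>m < 1\<close> by (simp add: pos_le_divide_eq)
    moreover have "interaction W M ?h ?h \<le> 0"
    proof -
      have "?h (fst z) * ?h (snd z) * W (snd z - fst z) \<le> 0" for z
        using neg[of "snd z - fst z"] dist_triangle_half_r[of x "fst z" R "snd z"]
        by (auto simp: indicator_def A_def dist_norm norm_minus_commute)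
      then have "0 \<le> (\<integral>z. - (?h (fst z) * ?h (snd z) * W (snd z - fst z)) \<partial>(M \<Otimes>\<^sub>M M))"
        by (intro Bochner_Integration.integral_nonneg) simp
      then show ?thesis
        by (simp add: interaction_def)
    qed
    ultimately have upper: "I \<le> J * (2 * m - m\<^sup>2)"
      by (simp add: algebra_simps power2_eq_square)
    have "- K * (measure M B * m) \<le> interaction W M (\<lambda>_. 1) ?h"
      unfolding m_def
    proof (rule interaction_ge)
      show "z \<in> B \<and> y \<in> A" if "1 * ?h y \<noteq> 0" "W (y - z) < 0" for z y
        using that nonneg[of "y - z"] near[of y z]
        by (auto simp: norm_minus_commute not_le[symmetric] split: split_indicator_asm)
    qed (use K in auto)
    moreover have "- K * (m * measure M B) \<le> interaction W M ?h (\<lambda>_. 1)"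
      unfolding m_def
    proof (rule interaction_ge)
      show "z \<in> A \<and> y \<in> B" if "?h z * 1 \<noteq> 0" "W (y - z) < 0" for z y
        using that nonneg[of "y - z"] near[of z y]
        by (auto simp: not_le[symmetric] split: split_indicator_asm)
    qed (use K in auto)
    ultimately have lower: "- (2 * K * measure M B * m) \<le> I"
      by (simp add: I_def mult_ac)
    show ?thesis
    proof (cases "J \<le> 0")
      case True
      have "m\<^sup>2 \<le> m"
        using \<open>0 < m\<close> \<open>m < 1\<close> by (simp add: power2_eq_square)
      then have "J * (2 * m - m\<^sup>2) \<le> J * m"
        using True by (intro mult_left_mono_neg) auto
      with upper lower have "(- J) * m \<le> (2 * K * measure M B) * m"
        by simp
      then have "- J \<le> 2 * K * measure M B"
        using \<open>0 < m\<close> by (rule mult_right_le_imp_le)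
      then show ?thesis
        using K by (simp add: J_def B_def field_simps)
    next
      case False
      then have "- J / (2 * K) \<le> 0"
        using K by (simp add: field_simps)
      then show ?thesis
        by (simp add: J_def order_trans[OF _ measure_nonneg])
    qed
  qed
qed

end

text \<open>
  A large ball around the origin has mass greater than \<open>1 - c\<close>; no ball of mass \<open>c\<close> can be
  disjoint from it.
\<close>

lemma bounded_if_ball_mass_ge:
  fixes M :: "'a::euclidean_space measure"
  assumes M: "M \<in> prob_measures" and "0 < c" and c: "\<And>x. x \<in> S \<Longrightarrow> c \<le> measure M (ball x \<rho>)"
  shows "bounded S"
proof -
  interpret prob_space M
    using M by (simp add: prob_measures_def)
  have sM: "sets M = sets borel" and spM: "space M = UNIV"
    using M sets_eq_imp_space_eq[of M borel] by (auto simp: prob_measures_def)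
  have "(\<Union>n. ball (0::'a) (real n)) = UNIV"
    using reals_Archimedean2 by auto
  moreover have "incseq (\<lambda>n. ball (0::'a) (real n))"
    by (intro incseq_SucI subset_ball) simp
  ultimately have "(\<lambda>n. prob (ball 0 (real n))) \<longlonglongrightarrow> 1"
    using finite_Lim_measure_incseq[of "\<lambda>n. ball 0 (real n)"] prob_space
    by (simp add: sM spM image_subset_iff)
  then have "\<forall>\<^sub>F n in sequentially. 1 - c < prob (ball 0 (real n))"
    using \<open>0 < c\<close> by (intro order_tendstoD) auto
  then obtain n where n: "1 - c < prob (ball 0 (real n))"
    by (auto simp: eventually_sequentially)
  have "norm x \<le> real n + \<rho>" if "x \<in> S" for x
  proof (rule ccontr)
    assume far: "\<not> norm x \<le> real n + \<rho>"
    have "ball 0 (real n) \<inter> ball x \<rho> = {}"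
      using far by (intro disjoint_ballI) simp
    then have "prob (ball 0 (real n)) + prob (ball x \<rho>) \<le> 1"
      by (subst finite_measure_Union[symmetric]) (auto simp: sM)
    then show False
      using n c[OF that] by simp
  qed
  then show ?thesis
    by (auto simp: bounded_iff)
qed

section \<open>Minimizers have isolated and, globally, finite support\<close>

lemma closed_supp: "closed (supp M)"
proof -
  have "- supp M = \<Union> {U. open U \<and> emeasure M U = 0}"
    by (auto simp: supp_def)
  then show ?thesis
    by (simp add: closed_def open_Union)
qed

theorem theorem1p1:
  fixes W :: "real ^ 'n \<Rightarrow> real" and w :: "real \<Rightarrow> real"
    and R \<alpha> C :: real and \<mu> :: "(real ^ 'n) measure"
  assumes radial: "\<And>x. W x = w (norm x)"
    and W_C2: "C2 W"
    and W_0: "W 0 = 0"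
    and R_pos: "R > 0"
    and W_neg: "\<And>x. 0 < norm x \<Longrightarrow> norm x < R \<Longrightarrow> W x < 0"
    and W_nonneg: "\<And>x. norm x \<ge> R \<Longrightarrow> W x \<ge> 0"
    and \<alpha>: "\<alpha> > 2"
    and C_pos: "C > 0"
    and w_deriv: "((\<lambda>r. deriv w r * r powr (1 - \<alpha>)) \<longlongrightarrow> - C) (at_right 0)"
    and local_min: "d_inf_local_minimizer (energy W) \<mu>"
    and finite_energy: "energy W \<mu> < \<infinity>"
  shows "(\<forall>x\<in>supp \<mu>. x isolated_in supp \<mu>) \<and>
         (global_minimizer (energy W) \<mu> \<longrightarrow> finite (supp \<mu>))"
proof -
  have diff: "W differentiable (at x)" for x
    using W_C2 by (auto simp: C2_def differentiable_def)
  then have cont: "continuous_on UNIV W"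
    by (simp add: continuous_at_imp_continuous_on differentiable_imp_continuous_within)
  then have W_meas: "W \<in> borel_measurable borel"
    by (rule borel_measurable_continuous_onI)
  have "compact (W ` cball 0 R)"
    using cont by (intro compact_continuous_image continuous_on_subset[OF cont]) auto
  then obtain K where K: "0 < K" "\<And>x. norm x \<le> R \<Longrightarrow> \<bar>W x\<bar> \<le> K"
    using compact_imp_bounded[THEN bounded_pos[THEN iffD1]] by (metis imageI mem_cball_0 real_norm_def)
  have W_ge: "- K \<le> W x" for x
    using K(1) K(2)[of x] W_nonneg[of x] by (cases "norm x \<le> R") auto
  have \<mu>: "\<mu> \<in> prob_measures"
    using local_min by (simp add: d_inf_local_minimizer_def)
  interpret finite_energy_measure W \<mu>
    by unfold_locales (fact \<mu> W_meas finite_energy_imp_integrable[OF \<mu> W_meas W_ge finite_energy])+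
  obtain \<epsilon> where \<epsilon>: "0 < \<epsilon>"
      "\<And>\<nu>. \<nu> \<in> prob_measures \<Longrightarrow> d_inf \<mu> \<nu> < ennreal \<epsilon> \<Longrightarrow> energy W \<mu> \<le> energy W \<nu>"
    using local_min by (auto simp: d_inf_local_minimizer_def)
  have isolated: "x isolated_in supp \<mu>" if "x \<in> supp \<mu>" for x
  proof (rule supp_point_isolated[OF radial diff W_0 R_pos W_neg \<alpha> C_pos w_deriv _ _ that])
    show "0 < \<epsilon> / 4"
      using \<epsilon>(1) by simp
    show "energy W \<mu> \<le> energy W \<nu>" if "\<nu> \<in> prob_measures" "d_inf \<mu> \<nu> \<le> ennreal (2 * (\<epsilon> / 4))" for \<nu>
      using \<epsilon> that by (intro \<epsilon>(2)) (auto elim!: order_le_less_trans simp: ennreal_less_iff)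
  qed
  moreover have "finite (supp \<mu>)" if "global_minimizer (energy W) \<mu>"
  proof -
    have min: "energy W \<mu> \<le> energy W \<nu>" if "\<nu> \<in> prob_measures" for \<nu>
      using \<open>global_minimizer (energy W) \<mu>\<close> that by (simp add: global_minimizer_def)
    obtain v :: "real ^ 'n" where "norm v = R / 2"
      using vector_choose_size[of "R / 2"] R_pos by auto
    then have "W v < 0" "W (- v) < 0"
      using R_pos by (auto intro!: W_neg)
    then obtain \<nu> where "\<nu> \<in> prob_measures" "energy W \<nu> < 0"
      using exists_negative_energy[OF W_meas W_0] by blast
    then have "energy W \<mu> < 0"
      using min by (blast intro: order_le_less_trans)
    then have J: "interaction W \<mu> (\<lambda>_. 1) (\<lambda>_. 1) < 0"
      by (simp add: energy_eq_interaction)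
    have "bounded (supp \<mu>)"
    proof (rule bounded_if_ball_mass_ge[OF \<mu>])
      show "0 < - interaction W \<mu> (\<lambda>_. 1) (\<lambda>_. 1) / (2 * K)"
        using J K(1) by (intro divide_pos_pos) auto
      have "W x \<le> 0" if "norm x < R" for x
        using W_neg[of x] W_0 that by (cases "x = 0") auto
      then show "- interaction W \<mu> (\<lambda>_. 1) (\<lambda>_. 1) / (2 * K) \<le> measure \<mu> (ball x (2 * R))"
        if "x \<in> supp \<mu>" for x
        using mass_near_supp_ge[OF R_pos _ W_nonneg K(1) W_ge min that] by blast
    qed
    then have "compact (supp \<mu>)"
      using closed_supp by (simp add: compact_eq_bounded_closed)
    then show ?thesis
      using isolated Heine_Borel_imp_Bolzano_Weierstrass[of "supp \<mu>" "supp \<mu>"]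
      by (auto simp: isolated_in_islimpt_iff)
  qed
  ultimately show ?thesis
    by blast
qed

end
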